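(* Let $q\in[1,\infty)$ and consider the type $q$-Wasserstein ambiguity set. Suppose that for every objective upper bound $t$ with $t\ge\min_{x\in\mathcal X}c^\top x$, the lower-level ALSO-X$\underline{\#}$ problem $\min\{L_q(x,\lambda,\beta):x\in\mathcal X,\ c^\top x\le t,\ \lambda\ge0,\ \beta\in\mathbb{R}\}$ admits a unique optimal $x$-solution (i.e., all optimal solutions $(x,\lambda,\beta)$ have the same $x$-component). Then ALSO-X# is better than ALSO-X$\underline{\#}$, i.e., $v_q^{A\#}\le v_q^{A\underline{\#}}$.
   Context: Data. $\mathcal X\subseteq\mathbb{R}^n$, $c\in\mathbb{R}^n$, $\varepsilon\in(0,1)$, $\theta\ge0$, $[I]=\{1,\dots,I\}$, $\|\cdot\|$ a norm on $\mathbb{R}^m$ with dual $\|\cdot\|_*$, $(y)_+=\max\{y,0\}$. For $i\in[I]$, $a_i(x)\in\mathbb{R}^m$ and $b_i(x)\in\mathbb{R}$ are affine in $x\in\mathbb{R}^n$. $\mathbb{P}_\zeta$ is the reference distribution of a random vector $\tilde\zeta$ in $\mathbb{R}^m$, assumed sub-Gaussian: $\mathbb{P}_\zeta\{\|\tilde\zeta\|\ge\tau\}\le C_1\exp(-C_2\tau^2)$ for some $C_1,C_2>0$. The type $q$-Wasserstein ambiguity set $\mathcal P_q$ is the set of probability distributions $\mathbb{P}$ on the support set $\Xi=\mathbb{R}^m$ with $W_q(\mathbb{P},\mathbb{P}_\zeta)\le\theta$, where $W_q(\mathbb{P}_1,\mathbb{P}_2)=\inf_{\mathbb{Q}}\big[\int\|\xi^1-\xi^2\|^q\,\mathbb{Q}(d\xi^1,d\xi^2)\big]^{1/q}$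 over couplings $\mathbb{Q}$ of $\mathbb{P}_1,\mathbb{P}_2$. Let $$Z_q=\Big\{x\in\mathbb{R}^n:\inf_{\mathbb{P}\in\mathcal P_q}\mathbb{P}\{a_i(x)^\top\tilde\xi\le b_i(x),\ \forall i\in[I]\}\ge1-\varepsilon\Big\}.$$ For $q>1$, $P_{q,i}(x,\lambda)=\|a_i(x)\|_*^{\frac q{q-1}}\lambda^{-\frac1{q-1}}q^{-\frac q{q-1}}(q-1)$ (for $\lambda=0$: $0$ if $a_i(x)=0$ and $+\infty$ otherwise); for $q=1$, $P_{1,i}(x,\lambda)=0$ if $\|a_i(x)\|_*\le\lambda$ and $+\infty$ otherwise. Put $$L_q(x,\lambda,\beta)=\varepsilon\beta+\lambda\theta^q+\mathbb{E}_{\mathbb{P}_\zeta}\Big[\max_{i\in[I]}\big(a_i(x)^\top\tilde\zeta-b_i(x)+P_{q,i}(x,\lambda)-\beta\big)_+\Big].$$ ALSO-X#: $v_q^{A\#}$ is the minimum (infimum) of all $t$ for which there is $(x^*,\lambda^*,\beta^* )\in\arg\min\{L_q(x,\lambda,\beta):x\in\mathcal X,\ c^\top x\le t,\ \lambda\ge0,\ \beta\le0\}$ with $x^*\in Z_q$. ALSO-X$\underline{\#}$: $v_q^{A\underline{\#}}$ is the minimum (infimum) of all $t$ for which there is $(x^*,\lambda^*,\beta^* )\in\arg\min\{L_q(x,\lambda,\beta):x\in\mathcal X,\ c^\top x\le t,\ \lambda\ge0,\ \beta\in\mathbb{R}\}$ with $x^*\in Z_q$. Conventions: an infimum over the empty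 set is $+\infty$; the lower-level minimization problems are understood to attain their minimum whenever they are feasible. *)

theory Defs
  imports "HOL-Probability.Probability"
begin

definition is_norm :: "('a::real_vector \<Rightarrow> real) \<Rightarrow> bool" where
  "is_norm N \<longleftrightarrow>
     (\<forall>v. 0 \<le> N v) \<and> (\<forall>v. N v = 0 \<longleftrightarrow> v = 0) \<and>
     (\<forall>r v. N (r *\<^sub>R v) = \<bar>r\<bar> * N v) \<and> (\<forall>v w. N (v + w) \<le> N v + N w)"

definition dual_norm :: "('a::real_inner \<Rightarrow> real) \<Rightarrow> 'a \<Rightarrow> real" where
  "dual_norm N y = (SUP v\<in>{v. N v \<le> 1}. y \<bullet> v)"

definition affine_map :: "('a::real_vector \<Rightarrow> 'b::real_vector) \<Rightarrow> bool" where
  "affine_map f \<longleftrightarrow> (\<exists>h v. linear h \<and> (\<forall>x. f x = h x + v))"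

definition borel_prob :: "'a::topological_space measure \<Rightarrow> bool" where
  "borel_prob P \<longleftrightarrow> prob_space P \<and> sets P = sets borel"

(* Only nonnegative thresholds: for negative ones the tail bound would be
   violated by every distribution. *)
definition sub_gaussian :: "('a::topological_space \<Rightarrow> real) \<Rightarrow> 'a measure \<Rightarrow> bool" where
  "sub_gaussian N P \<longleftrightarrow>
     (\<exists>C1>0. \<exists>C2>0. \<forall>\<tau>\<ge>0. measure P {z. \<tau> \<le> N z} \<le> C1 * exp (- C2 * \<tau>\<^sup>2))"

definition couplings :: "'a::topological_space measure \<Rightarrow> 'a measure \<Rightarrow> ('a \<times> 'a) measure set" where
  "couplings P1 P2 =
     {Q. prob_space Q \<and> sets Q = sets (borel \<Otimes>\<^sub>M borel) \<and>
         distr Q borel fst = P1 \<and> distr Q borel snd = P2}"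

definition ennreal_powr :: "ennreal \<Rightarrow> real \<Rightarrow> ennreal" where
  "ennreal_powr y p = (if y = \<infinity> then \<infinity> else ennreal (enn2real y powr p))"

definition wasserstein ::
  "('a::real_normed_vector \<Rightarrow> real) \<Rightarrow> real \<Rightarrow> 'a measure \<Rightarrow> 'a measure \<Rightarrow> ennreal" where
  "wasserstein N q P1 P2 =
     (INF Q\<in>couplings P1 P2.
        ennreal_powr (\<integral>\<^sup>+ (\<xi>1, \<xi>2). ennreal (N (\<xi>1 - \<xi>2) powr q) \<partial>Q) (1 / q))"

definition ambiguity_set ::
  "('a::real_normed_vector \<Rightarrow> real) \<Rightarrow> real \<Rightarrow> real \<Rightarrow> 'a measure \<Rightarrow> 'a measure set" where
  "ambiguity_set N q \<theta> P0 = {P. borel_prob P \<and> wasserstein N q P P0 \<le> ennreal \<theta>}"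

definition dr_feasible ::
  "(real^'m \<Rightarrow> real) \<Rightarrow> (real^'m) measure \<Rightarrow> nat \<Rightarrow> (nat \<Rightarrow> real^'n \<Rightarrow> real^'m) \<Rightarrow>
   (nat \<Rightarrow> real^'n \<Rightarrow> real) \<Rightarrow> real \<Rightarrow> real \<Rightarrow> real \<Rightarrow> (real^'n) set" where
  "dr_feasible N P0 I a b \<epsilon> \<theta> q =
     {x. (INF P\<in>ambiguity_set N q \<theta> P0.
            measure P {\<xi>. \<forall>i\<in>{1..I}. a i x \<bullet> \<xi> \<le> b i x}) \<ge> 1 - \<epsilon>}"

definition penalty :: "('a::real_inner \<Rightarrow> real) \<Rightarrow> real \<Rightarrow> 'a \<Rightarrow> real \<Rightarrow> ereal" where
  "penalty N q v l =
     (if q = 1 then (if dual_norm N v \<le> l then 0 else \<infinity>)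
      else if l = 0 then (if v = 0 then 0 else \<infinity>)
      else ereal (dual_norm N v powr (q / (q - 1)) * l powr (- (1 / (q - 1)))
                  * q powr (- (q / (q - 1))) * (q - 1)))"

definition L_obj ::
  "(real^'m \<Rightarrow> real) \<Rightarrow> (real^'m) measure \<Rightarrow> nat \<Rightarrow> (nat \<Rightarrow> real^'n \<Rightarrow> real^'m) \<Rightarrow>
   (nat \<Rightarrow> real^'n \<Rightarrow> real) \<Rightarrow> real \<Rightarrow> real \<Rightarrow> real \<Rightarrow> real^'n \<Rightarrow> real \<Rightarrow> real \<Rightarrow> ereal" where
  "L_obj N P0 I a b \<epsilon> \<theta> q x l \<beta> =
     ereal (\<epsilon> * \<beta> + l * \<theta> powr q) +
     enn2ereal (\<integral>\<^sup>+ z. e2ennreal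
        (MAX i\<in>{1..I}. max 0 (ereal (a i x \<bullet> z - b i x) + penalty N q (a i x) l - ereal \<beta>)) \<partial>P0)"

(* The set B is the range allowed for the variable beta: {..0} gives the lower-level
   problem of ALSO-X#, UNIV that of its variant with underlined #. *)
definition lower_sols ::
  "(real^'m \<Rightarrow> real) \<Rightarrow> (real^'m) measure \<Rightarrow> nat \<Rightarrow> (nat \<Rightarrow> real^'n \<Rightarrow> real^'m) \<Rightarrow>
   (nat \<Rightarrow> real^'n \<Rightarrow> real) \<Rightarrow> real \<Rightarrow> real \<Rightarrow> real \<Rightarrow> (real^'n) set \<Rightarrow> real^'n \<Rightarrow>
   real set \<Rightarrow> real \<Rightarrow> ((real^'n) \<times> real \<times> real) set" where
  "lower_sols N P0 I a b \<epsilon> \<theta> q X c B t =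
     {s. is_arg_min (\<lambda>(x, l, \<beta>). L_obj N P0 I a b \<epsilon> \<theta> q x l \<beta>)
           (\<lambda>(x, l, \<beta>). x \<in> X \<and> c \<bullet> x \<le> t \<and> 0 \<le> l \<and> \<beta> \<in> B) s}"

definition alsox_value ::
  "(real^'m \<Rightarrow> real) \<Rightarrow> (real^'m) measure \<Rightarrow> nat \<Rightarrow> (nat \<Rightarrow> real^'n \<Rightarrow> real^'m) \<Rightarrow>
   (nat \<Rightarrow> real^'n \<Rightarrow> real) \<Rightarrow> real \<Rightarrow> real \<Rightarrow> real \<Rightarrow> (real^'n) set \<Rightarrow> real^'n \<Rightarrow>
   real set \<Rightarrow> ereal" where
  "alsox_value N P0 I a b \<epsilon> \<theta> q X c B =
     Inf {ereal t | t. \<exists>(x, l, \<beta>) \<in> lower_sols N P0 I a b \<epsilon> \<theta> q X c B t.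
                         x \<in> dr_feasible N P0 I a b \<epsilon> \<theta> q}"

abbreviation "v_sharp N P0 I a b \<epsilon> \<theta> q X c \<equiv> alsox_value N P0 I a b \<epsilon> \<theta> q X c {..0}"
abbreviation "v_sharp_underline N P0 I a b \<epsilon> \<theta> q X c \<equiv> alsox_value N P0 I a b \<epsilon> \<theta> q X c UNIV"

end

theory Submission
  imports Defs
begin

text \<open>
  Let \<open>(x, l, \<beta>)\<close> solve the lower-level problem with free \<open>\<beta>\<close>, where \<open>x\<close> satisfies the chance
  constraint. If \<open>\<beta> \<le> 0\<close>, it also solves the problem restricted to \<open>\<beta> \<le> 0\<close>. The point is that for
  \<open>\<beta> > 0\<close> nothing is lost by restricting to \<open>\<beta> \<le> 0\<close> either: then the two problems have the same optimal
  value, so a solution of the restricted one, which exists by assumption, solves the free one as well,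
  and by uniqueness its first component is \<open>x\<close>. So the same bound \<open>t\<close> is admissible for ALSO-X#.

  That nothing is lost is seen on the primal side. For fixed \<open>x\<close> and \<open>\<beta>\<close>, the infimum of the objective
  over \<open>l\<close> is the Lagrangian dual of \<open>\<epsilon> * \<beta>\<close> plus the supremum, over the Wasserstein ball, of the expected
  positive excess of the worst constraint function over \<open>\<beta>\<close>. Lowering the threshold from \<open>\<beta>\<close> to \<open>0\<close>
  increases this excess by at most \<open>\<beta>\<close> and only on the event that a constraint is violated, which has
  probability at most \<open>\<epsilon>\<close> under every distribution in the ball (\<open>chance_bound\<close>); the loss is thus made
  up for by the term \<open>\<epsilon> * \<beta>\<close>. To return to the dual side, weak duality is used at \<open>(l, \<beta>)\<close> and
  strong duality at threshold \<open>0\<close>.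

  Weak duality (\<open>weak_duality\<close>) is Young's inequality integrated against a coupling. Strong duality
  (\<open>strong_duality\<close>) is proved by exhibiting nearly optimal transports. For \<open>q > 1\<close>
  and a ball of positive radius, every price \<open>l > 0\<close> has an explicit optimal shift
  (\<open>optimal_shift\<close>), and a mixture of the shifts for two neighbouring prices meets the transport
  budget exactly. For \<open>q = 1\<close> a small fraction of the mass is sent far away, and for
  radius zero the penalties vanish as the price grows.
\<close>

section \<open>Norms and dual norms\<close>

lemma is_normD:
  assumes "is_norm N"
  shows is_norm_nonneg: "0 \<le> N v"
    and is_norm_eq_0_iff: "N v = 0 \<longleftrightarrow> v = 0"
    and is_norm_scaleR: "N (r *\<^sub>R v) = \<bar>r\<bar> * N v"
    and is_norm_triangle: "N (v + w) \<le> N v + N w"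
  using assms by (auto simp: is_norm_def)

lemma is_norm_zero: "is_norm N \<Longrightarrow> N 0 = 0"
  by (simp add: is_norm_eq_0_iff)

lemma continuous_on_is_norm:
  fixes N :: "'a::euclidean_space \<Rightarrow> real"
  assumes "is_norm N"
  shows "continuous_on A N"
proof -
  have "convex_on UNIV N"
  proof (rule convex_onI)
    fix t :: real and x y :: 'a assume "0 < t" "t < 1"
    then show "N ((1 - t) *\<^sub>R x + t *\<^sub>R y) \<le> (1 - t) * N x + t * N y"
      using is_norm_triangle[OF assms, of "(1 - t) *\<^sub>R x" "t *\<^sub>R y"]
      by (simp add: is_norm_scaleR[OF assms])
  qed simp
  then have "continuous_on UNIV N"
    by (rule convex_on_continuous[OF open_UNIV])
  then show ?thesis
    by (rule continuous_on_subset) simp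
qed

lemma borel_measurable_is_norm:
  fixes N :: "'a::euclidean_space \<Rightarrow> real"
  assumes "is_norm N"
  shows "N \<in> borel_measurable borel"
  using continuous_on_is_norm[OF assms] by (rule borel_measurable_continuous_onI)

text \<open>Closedness is continuity of \<open>N\<close>; boundedness holds because \<open>N\<close> is positive on the Euclidean
  unit sphere, hence bounded away from zero there by compactness, and is homogeneous.\<close>
lemma compact_is_norm_ball:
  fixes N :: "'a::euclidean_space \<Rightarrow> real"
  assumes N: "is_norm N"
  shows "compact {v. N v \<le> 1}"
proof -
  have "closed {v. N v \<le> 1}"
    by (intro closed_Collect_le continuous_on_is_norm[OF N] continuous_intros)
  moreover have "bounded {v. N v \<le> 1}"
  proof -
    have "compact (sphere (0::'a) 1)" "sphere (0::'a) 1 \<noteq> {}" by auto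
    then obtain u where u: "u \<in> sphere (0::'a) 1" and min: "\<And>v. v \<in> sphere 0 1 \<Longrightarrow> N u \<le> N v"
      using continuous_attains_inf[OF _ _ continuous_on_is_norm[OF N]] by metis
    have pos: "N u > 0"
      using u is_norm_nonneg[OF N, of u] is_norm_eq_0_iff[OF N, of u] by fastforce
    have "norm v \<le> 1 / N u" if "N v \<le> 1" for v
    proof (cases "v = 0")
      case True then show ?thesis using pos by simp
    next
      case False
      then have "N u \<le> N ((1 / norm v) *\<^sub>R v)" by (intro min) simp
      also have "\<dots> = N v / norm v" by (simp add: is_norm_scaleR[OF N])
      also have "\<dots> \<le> 1 / norm v" using that by (simp add: divide_right_mono)
      finally show ?thesis using pos False by (simp add: field_simps)
    qed
    then show ?thesis unfolding bounded_iff by blast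
  qed
  ultimately show ?thesis by (simp add: compact_eq_bounded_closed)
qed

text \<open>Compactness of the ball makes the supremum in the dual norm a maximum. A maximizer is a direction in
  which a point has to be moved to increase a linear function as fast as possible per unit of cost.\<close>
lemma dual_norm_attained:
  fixes N :: "'a::euclidean_space \<Rightarrow> real"
  assumes N: "is_norm N"
  obtains v where "N v \<le> 1" "y \<bullet> v = dual_norm N y" "\<And>w. N w \<le> 1 \<Longrightarrow> y \<bullet> w \<le> dual_norm N y"
proof -
  have ne: "{v. N v \<le> 1} \<noteq> {}" using is_norm_zero[OF N] by (auto intro: exI[of _ 0])
  have "continuous_on {v. N v \<le> 1} (\<lambda>v. y \<bullet> v)" by (intro continuous_intros)
  from continuous_attains_sup[OF compact_is_norm_ball[OF N] ne this]
  obtain v where v: "N v \<le> 1" "\<And>w. N w \<le> 1 \<Longrightarrow> y \<bullet> w \<le> y \<bullet> v" by auto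
  then have "dual_norm N y = y \<bullet> v"
    unfolding dual_norm_def by (intro cSup_eq_maximum) auto
  with v that show ?thesis by metis
qed

lemma dual_norm_nonneg:
  fixes N :: "'a::euclidean_space \<Rightarrow> real"
  assumes N: "is_norm N"
  shows "0 \<le> dual_norm N y"
  using dual_norm_attained[OF N, of y] is_norm_zero[OF N] by (metis inner_zero_right zero_le_one)

lemma inner_le_dual_norm:
  fixes N :: "'a::euclidean_space \<Rightarrow> real"
  assumes N: "is_norm N"
  shows "y \<bullet> w \<le> dual_norm N y * N w"
proof (cases "w = 0")
  case True then show ?thesis by (simp add: is_norm_zero[OF N])
next
  case False
  then have pos: "N w > 0" using is_norm_nonneg[OF N, of w] is_norm_eq_0_iff[OF N, of w] by linarith
  then have "N ((1 / N w) *\<^sub>R w) \<le> 1" by (simp add: is_norm_scaleR[OF N])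
  then have "y \<bullet> ((1 / N w) *\<^sub>R w) \<le> dual_norm N y"
    by (metis dual_norm_attained[OF N])
  with pos show ?thesis by (simp add: field_simps)
qed

lemma dual_norm_zero:
  fixes N :: "'a::euclidean_space \<Rightarrow> real"
  assumes N: "is_norm N"
  shows "dual_norm N 0 = 0"
  using dual_norm_attained[OF N, of 0] by (metis inner_zero_left)

section \<open>The penalty as the value of an optimal displacement\<close>

text \<open>For \<open>q > 1\<close> and \<open>l > 0\<close>, the maximizer of the concave function \<open>\<lambda>r. D * r - l * r powr q\<close> over
  \<open>r \<ge> 0\<close>, that is, the root of \<open>D = l * q * r powr (q - 1)\<close>: how far it pays to move a point against a loss of slope \<open>D\<close>, if
  transport costs \<open>l\<close> per unit of \<open>q\<close>-th power.\<close>
definition optimal_radius :: "real \<Rightarrow> real \<Rightarrow> real \<Rightarrow> real" where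
  "optimal_radius q D l = (D / (l * q)) powr (1 / (q - 1))"

lemma penalty_eq_value_at_optimal_radius:
  fixes N :: "'a::euclidean_space \<Rightarrow> real" and y :: 'a
  assumes N: "is_norm N" and q: "1 < q" and l: "0 < l"
  defines "r \<equiv> optimal_radius q (dual_norm N y) l"
  shows "penalty N q y l = ereal (dual_norm N y * r - l * r powr q)"
proof -
  define D where "D = dual_norm N y"
  have D: "0 \<le> D" by (simp add: D_def dual_norm_nonneg[OF N])
  have "D powr (q / (q - 1)) * l powr (- (1 / (q - 1))) * q powr (- (q / (q - 1))) * (q - 1)
      = D * r - l * r powr q"
  proof (cases "D = 0")
    case True
    then show ?thesis using q by (simp add: r_def optimal_radius_def D_def)
  next
    case False
    then have D: "0 < D" using D by simp
    have r: "r = D powr (1 / (q - 1)) * l powr (- (1 / (q - 1))) * q powr (- (1 / (q - 1)))"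
      using D l q by (simp add: r_def optimal_radius_def D_def powr_divide powr_mult powr_minus field_simps)
    have r0: "0 < r" using r D l q by simp
    have "r powr (q - 1) = D / (l * q)"
      using D l q by (simp add: r_def optimal_radius_def D_def[symmetric] powr_powr)
    then have rq: "l * r powr q = D * r / q"
      using r0 l q powr_add[of r "q - 1" 1] by (simp add: field_simps)
    have exponent: "q / (q - 1) = 1 + 1 / (q - 1)" using q by (simp add: field_simps)
    have e: "D powr (q / (q - 1)) = D * D powr (1 / (q - 1))"
      "q powr (- (q / (q - 1))) = q powr (- (1 / (q - 1))) / q"
      unfolding exponent powr_minus powr_add using D q by (simp_all add: divide_inverse)
    show ?thesis unfolding rq e
      using q by (simp add: r field_simps)
  qed
  then show ?thesis using q l by (simp add: penalty_def D_def)
qed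

text \<open>The penalty is the supremum over \<open>t \<ge> 0\<close> of the gain \<open>dual_norm N y * t\<close> minus the cost
  \<open>l * t powr q\<close>. This is the upper-bound half, which for \<open>q > 1\<close> and \<open>l > 0\<close> is an instance of Young's
  inequality; in that case the supremum is attained at the optimal radius.\<close>
lemma dual_norm_mult_le_penalty:
  fixes N :: "'a::euclidean_space \<Rightarrow> real"
  assumes N: "is_norm N" and q: "1 \<le> q" and l: "0 \<le> l" and t: "0 \<le> t"
  shows "ereal (dual_norm N y * t) \<le> penalty N q y l + ereal (l * t powr q)"
proof -
  define D where "D = dual_norm N y"
  have D: "0 \<le> D" by (simp add: D_def dual_norm_nonneg[OF N])
  consider "q = 1" | "q > 1" "l = 0" | "q > 1" "l > 0" using q l by linarith
  then show ?thesis
  proof cases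
    case 1
    then show ?thesis using t by (auto simp: penalty_def mult_right_mono)
  next
    case 2
    then show ?thesis by (auto simp: penalty_def dual_norm_zero[OF N])
  next
    case 3
    define p where "p = q / (q - 1)"
    define k where "k = (l * q) powr (1 / q)"
    have k: "k > 0" using 3 by (simp add: k_def)
    have kq: "k powr q = l * q" using 3 by (simp add: k_def powr_powr)
    \<comment> \<open>The scaling by \<open>k\<close> turns the term \<open>(k * t) powr q / q\<close> of Young's inequality into the transport cost.\<close>
    have "(D / k) * (k * t) \<le> (D / k) powr p / p + (k * t) powr q / q"
      using 3 D k t by (intro Youngs_inequality) (auto simp: p_def field_simps)
    also have "(D / k) * (k * t) = D * t" using k by simp
    also have "(k * t) powr q / q = l * t powr q"
      using k t 3 by (simp add: powr_mult kq)
    also have "(D / k) powr p / p = D powr (q / (q - 1)) * l powr (- (1 / (q - 1))) * q powr (- (q / (q - 1))) * (q - 1)"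
    proof -
      have "k powr p = (l * q) powr (1 / (q - 1))" using 3 by (simp add: k_def p_def powr_powr)
      then have kp: "inverse (k powr p) = l powr (- (1 / (q - 1))) * q powr (- (1 / (q - 1)))"
        using 3 by (simp add: powr_mult powr_minus)
      have "- (q / (q - 1)) = - (1 / (q - 1)) - 1" using 3 by (simp add: field_simps)
      then have e: "q powr (- (q / (q - 1))) = q powr (- (1 / (q - 1))) / q"
        using 3 by (simp add: powr_diff)
      have "(D / k) powr p / p = D powr p * inverse (k powr p) / p"
        using D k by (subst powr_divide) (auto simp: divide_inverse)
      then show ?thesis unfolding kp e using 3 by (simp add: p_def field_simps)
    qed
    finally show ?thesis using 3 by (simp add: penalty_def D_def)
  qed
qed

lemma optimal_radius_small:
  assumes q: "1 < q" and \<rho>: "0 < \<rho>" and D: "0 \<le> D" and l: "D / (q * \<rho> powr (q - 1)) \<le> l" "0 < l"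
  shows "optimal_radius q D l \<le> \<rho>"
proof -
  have "D / (l * q) \<le> \<rho> powr (q - 1)"
    using assms by (simp add: field_simps)
  then have "optimal_radius q D l \<le> (\<rho> powr (q - 1)) powr (1 / (q - 1))"
    unfolding optimal_radius_def using assms by (intro powr_mono2) auto
  then show ?thesis using q \<rho> by (simp add: powr_powr)
qed

section \<open>The robust loss and the lower-level objective\<close>

text \<open>The integrand of the lower-level objective. The truncation at zero is left to the conversion into
  \<open>ennreal\<close>, and \<open>\<beta>\<close> is absorbed into the offsets \<open>w\<close>, so that with penalty zero this is also the
  positive part of the worst constraint violation.\<close>
definition robust_loss ::
  "'i set \<Rightarrow> ('i \<Rightarrow> 'a::real_inner) \<Rightarrow> ('i \<Rightarrow> real) \<Rightarrow> ('i \<Rightarrow> ereal) \<Rightarrow> 'a \<Rightarrow> ennreal" where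
  "robust_loss J u w p z = (MAX i\<in>J. e2ennreal (ereal (u i \<bullet> z - w i) + p i))"

abbreviation "affine_loss J u w \<equiv> robust_loss J u w (\<lambda>_. 0)"

lemma borel_measurable_robust_loss [measurable]:
  fixes u :: "'i \<Rightarrow> 'a::euclidean_space"
  assumes "finite J"
  shows "robust_loss J u w p \<in> borel_measurable borel"
  unfolding robust_loss_def using assms by measurable

lemma robust_loss_ge:
  "finite J \<Longrightarrow> i \<in> J \<Longrightarrow> e2ennreal (ereal (u i \<bullet> z - w i) + p i) \<le> robust_loss J u w p z"
  unfolding robust_loss_def by (intro Max_ge) auto

lemma affine_loss_ge:
  "finite J \<Longrightarrow> i \<in> J \<Longrightarrow> ennreal (u i \<bullet> z - w i) \<le> affine_loss J u w z"
  using robust_loss_ge[of J i u z w "\<lambda>_. 0"] by (simp flip: zero_ereal_def)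

lemma robust_loss_le:
  assumes "finite J" "J \<noteq> {}"
    and "\<And>i. i \<in> J \<Longrightarrow> e2ennreal (ereal (u i \<bullet> z - w i) + p i) \<le> B"
  shows "robust_loss J u w p z \<le> B"
  unfolding robust_loss_def using assms by (intro Max.boundedI) auto

lemma e2ennreal_add_le:
  assumes "x \<le> y + ereal r" "0 \<le> r"
  shows "e2ennreal x \<le> e2ennreal y + ennreal r"
proof (cases y)
  case (real y')
  then have "e2ennreal x \<le> ennreal (y' + r)"
    using e2ennreal_mono[OF assms(1)] by simp
  also have "\<dots> \<le> ennreal (max 0 y' + r)" by (intro ennreal_leI) auto
  also have "\<dots> = ennreal y' + ennreal r"
    using assms(2) by (subst ennreal_plus) (auto simp: ennreal_max_0)
  finally show ?thesis using real by simp
next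
  case PInf then show ?thesis by simp
next
  case MInf then show ?thesis using assms by (simp add: e2ennreal_neg)
qed

text \<open>Moving \<open>\<zeta>\<close> to \<open>\<xi>\<close> raises the \<open>i\<close>-th affine function by at most \<open>dual_norm N (u i) * N (\<xi> - \<zeta>)\<close>, and
  the penalty pays for what the transport cost does not. Integrated against a coupling, this is weak
  duality.\<close>
lemma affine_loss_le_robust_loss_plus_cost:
  fixes N :: "'a::euclidean_space \<Rightarrow> real"
  assumes N: "is_norm N" and q: "1 \<le> q" and l: "0 \<le> l" and J: "finite J" "J \<noteq> {}"
  shows "affine_loss J u w \<xi> \<le> robust_loss J u w (\<lambda>i. penalty N q (u i) l) \<zeta> + ennreal (l * N (\<xi> - \<zeta>) powr q)"
proof (rule robust_loss_le[OF J])
  fix i assume i: "i \<in> J"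
  have "u i \<bullet> \<xi> - w i \<le> (u i \<bullet> \<zeta> - w i) + dual_norm N (u i) * N (\<xi> - \<zeta>)"
    using inner_le_dual_norm[OF N, of "u i" "\<xi> - \<zeta>"] by (simp add: inner_diff_right)
  then have "ereal (u i \<bullet> \<xi> - w i) \<le> ereal (u i \<bullet> \<zeta> - w i) + ereal (dual_norm N (u i) * N (\<xi> - \<zeta>))"
    by simp
  also have "\<dots> \<le> ereal (u i \<bullet> \<zeta> - w i) + (penalty N q (u i) l + ereal (l * N (\<xi> - \<zeta>) powr q))"
    by (intro add_left_mono dual_norm_mult_le_penalty N q l is_norm_nonneg)
  finally have "e2ennreal (ereal (u i \<bullet> \<xi> - w i) + 0)
      \<le> e2ennreal (ereal (u i \<bullet> \<zeta> - w i) + penalty N q (u i) l) + ennreal (l * N (\<xi> - \<zeta>) powr q)"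
    using l by (intro e2ennreal_add_le) (auto simp: add.assoc)
  also have "\<dots> \<le> robust_loss J u w (\<lambda>i. penalty N q (u i) l) \<zeta> + ennreal (l * N (\<xi> - \<zeta>) powr q)"
    by (intro add_right_mono robust_loss_ge J i)
  finally show "e2ennreal (ereal (u i \<bullet> \<xi> - w i) + 0) \<le> \<dots>" .
qed

lemma L_obj_eq_robust_loss:
  assumes "I \<ge> 1" "0 \<le> \<epsilon> * \<beta> + l * \<theta> powr q"
  shows "L_obj N P0 I a b \<epsilon> \<theta> q x l \<beta> = enn2ereal (ennreal (\<epsilon> * \<beta> + l * \<theta> powr q) +
    (\<integral>\<^sup>+z. robust_loss {1..I} (\<lambda>i. a i x) (\<lambda>i. b i x + \<beta>) (\<lambda>i. penalty N q (a i x) l) z \<partial>P0))"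
proof -
  have summand: "e2ennreal (max 0 (ereal (a i x \<bullet> z - b i x) + penalty N q (a i x) l - ereal \<beta>))
      = e2ennreal (ereal (a i x \<bullet> z - (b i x + \<beta>)) + penalty N q (a i x) l)" for i z
  proof -
    have "e2ennreal (max 0 y) = e2ennreal y" for y by (simp add: e2ennreal_def)
    moreover have "ereal (a i x \<bullet> z - b i x) + penalty N q (a i x) l - ereal \<beta>
        = ereal (a i x \<bullet> z - (b i x + \<beta>)) + penalty N q (a i x) l"
      by (cases "penalty N q (a i x) l") auto
    ultimately show ?thesis by simp
  qed
  have "e2ennreal (MAX i\<in>{1..I}. max 0 (ereal (a i x \<bullet> z - b i x) + penalty N q (a i x) l - ereal \<beta>))
      = robust_loss {1..I} (\<lambda>i. a i x) (\<lambda>i. b i x + \<beta>) (\<lambda>i. penalty N q (a i x) l) z" for z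
    unfolding robust_loss_def summand[symmetric] using assms(1)
    by (subst mono_Max_commute) (auto simp: mono_def e2ennreal_mono image_image)
  then show ?thesis
    using assms(2) by (simp add: L_obj_def plus_ennreal.rep_eq)
qed

section \<open>Couplings, weak duality and the chance constraint\<close>

definition transport_cost :: "('a::real_normed_vector \<Rightarrow> real) \<Rightarrow> real \<Rightarrow> ('a \<times> 'a) measure \<Rightarrow> ennreal" where
  "transport_cost N q Q = (\<integral>\<^sup>+ (\<xi>1, \<xi>2). ennreal (N (\<xi>1 - \<xi>2) powr q) \<partial>Q)"

text \<open>The worst-case distributions below come with an explicit coupling, whose cost bounds the infimum
  that defines the Wasserstein distance.\<close>
lemma coupling_in_ambiguity_set:
  assumes Q: "Q \<in> couplings P P0" and cost: "transport_cost N q Q \<le> ennreal (\<theta> powr q)"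
    and \<theta>: "0 \<le> \<theta>" and q: "1 \<le> q"
  shows "P \<in> ambiguity_set N q \<theta> P0"
proof -
  from Q have prob: "prob_space Q" and sets: "sets Q = sets (borel \<Otimes>\<^sub>M borel)"
    and P: "P = distr Q borel fst"
    by (auto simp: couplings_def)
  have "fst \<in> measurable Q borel"
    unfolding measurable_cong_sets[OF sets refl] by measurable
  then have "borel_prob P"
    unfolding borel_prob_def P using prob by (auto intro: prob_space.prob_space_distr)
  moreover have "wasserstein N q P P0 \<le> ennreal_powr (transport_cost N q Q) (1 / q)"
    unfolding wasserstein_def transport_cost_def by (rule INF_lower[OF Q])
  moreover have "ennreal_powr (transport_cost N q Q) (1 / q) \<le> ennreal \<theta>"
  proof -
    have fin: "transport_cost N q Q < top" using cost by (rule order.strict_trans1) simp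
    have "enn2real (transport_cost N q Q) \<le> \<theta> powr q"
      using enn2real_mono[OF cost] by simp
    then have "enn2real (transport_cost N q Q) powr (1 / q) \<le> (\<theta> powr q) powr (1 / q)"
      using q by (intro powr_mono2) auto
    also have "\<dots> = \<theta>" using \<theta> q by (cases "\<theta> = 0") (simp_all add: powr_powr)
    finally show ?thesis using fin by (auto simp: ennreal_powr_def intro: ennreal_leI)
  qed
  ultimately show ?thesis unfolding ambiguity_set_def by (auto intro: order.trans)
qed

lemma weak_duality:
  fixes N :: "'a::euclidean_space \<Rightarrow> real"
  assumes N: "is_norm N" and q: "1 \<le> q" and l: "0 \<le> l" and J: "finite J" "J \<noteq> {}"
    and Q: "Q \<in> couplings P P0" and cost: "transport_cost N q Q \<le> ennreal s" and s: "0 \<le> s"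
  shows "(\<integral>\<^sup>+\<xi>. affine_loss J u w \<xi> \<partial>P)
    \<le> ennreal (l * s) + (\<integral>\<^sup>+\<zeta>. robust_loss J u w (\<lambda>i. penalty N q (u i) l) \<zeta> \<partial>P0)"
proof -
  let ?R = "robust_loss J u w (\<lambda>i. penalty N q (u i) l)"
  from Q have sets: "sets Q = sets (borel \<Otimes>\<^sub>M borel)"
    and P: "P = distr Q borel fst" and P0: "P0 = distr Q borel snd"
    by (auto simp: couplings_def)
  note [measurable_cong] = sets and [measurable] = borel_measurable_is_norm[OF N] and [simp] = J(1)
  have "(\<integral>\<^sup>+\<xi>. affine_loss J u w \<xi> \<partial>P) = (\<integral>\<^sup>+x. affine_loss J u w (fst x) \<partial>Q)"
    unfolding P by (rule nn_integral_distr) measurable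
  also have "\<dots> \<le> (\<integral>\<^sup>+x. ?R (snd x) + ennreal l * ennreal (N (fst x - snd x) powr q) \<partial>Q)"
    using affine_loss_le_robust_loss_plus_cost[OF N q l J] l
    by (intro nn_integral_mono) (simp flip: ennreal_mult')
  also have "\<dots> = (\<integral>\<^sup>+x. ?R (snd x) \<partial>Q) + ennreal l * transport_cost N q Q"
    unfolding transport_cost_def case_prod_beta
    by (subst nn_integral_add) (auto simp: nn_integral_cmult)
  also have "(\<integral>\<^sup>+x. ?R (snd x) \<partial>Q) = (\<integral>\<^sup>+\<zeta>. ?R \<zeta> \<partial>P0)"
    unfolding P0 by (rule nn_integral_distr[symmetric]) measurable
  also have "ennreal l * transport_cost N q Q \<le> ennreal (l * s)"
    using cost l s by (simp add: ennreal_mult mult_left_mono)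
  finally show ?thesis by (simp add: add_left_mono add.commute)
qed

text \<open>Lowering the threshold from \<open>\<beta>\<close> to \<open>0\<close> raises the loss by at most \<open>\<beta>\<close>, and only where a constraint is
  violated. For \<open>x\<close> feasible in the chance constraint this happens with probability at most \<open>\<epsilon>\<close>
  under every distribution of the ambiguity set, so the price of the lower threshold is at most \<open>\<epsilon> * \<beta>\<close>.\<close>
lemma chance_bound:
  fixes N :: "real^'m \<Rightarrow> real"
  assumes I: "I \<ge> 1" and \<beta>: "0 \<le> \<beta>" and e: "0 \<le> \<epsilon>"
    and x: "x \<in> dr_feasible N P0 I a b \<epsilon> \<theta> q" and P: "P \<in> ambiguity_set N q \<theta> P0"
  shows "(\<integral>\<^sup>+\<xi>. affine_loss {1..I} (\<lambda>i. a i x) (\<lambda>i. b i x) \<xi> \<partial>P)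
    \<le> ennreal (\<epsilon> * \<beta>) + (\<integral>\<^sup>+\<xi>. affine_loss {1..I} (\<lambda>i. a i x) (\<lambda>i. b i x + \<beta>) \<xi> \<partial>P)"
proof -
  let ?A = "{\<xi>. \<forall>i\<in>{1..I}. a i x \<bullet> \<xi> \<le> b i x}"
  have "prob_space P" and sets: "sets P = sets borel"
    using P by (auto simp: ambiguity_set_def borel_prob_def)
  interpret prob_space P by fact
  have space: "space P = UNIV" using sets_eq_imp_space_eq[OF sets] by simp
  note [measurable_cong] = sets
  have A[measurable]: "?A \<in> sets P" by measurable
  have J: "finite {1..I}" "{1..I} \<noteq> {}" using I by auto
  have "(INF P\<in>ambiguity_set N q \<theta> P0. measure P ?A) \<le> measure P ?A"
    by (intro cINF_lower P bdd_belowI2[of _ 0]) simp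
  then have "1 - \<epsilon> \<le> prob ?A" using x by (simp add: dr_feasible_def)
  then have "prob (- ?A) \<le> \<epsilon>"
    using prob_compl[OF A] by (simp add: space Compl_eq_Diff_UNIV)
  then have viol: "emeasure P (- ?A) \<le> ennreal \<epsilon>"
    by (simp add: emeasure_eq_measure ennreal_leI)
  have "affine_loss {1..I} (\<lambda>i. a i x) (\<lambda>i. b i x) \<xi>
    \<le> ennreal \<beta> * indicator (- ?A) \<xi> + affine_loss {1..I} (\<lambda>i. a i x) (\<lambda>i. b i x + \<beta>) \<xi>" for \<xi>
  proof (rule robust_loss_le[OF J])
    fix i assume i: "i \<in> {1..I}"
    show "e2ennreal (ereal (a i x \<bullet> \<xi> - b i x) + 0) \<le> ennreal \<beta> * indicator (- ?A) \<xi>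
      + affine_loss {1..I} (\<lambda>i. a i x) (\<lambda>i. b i x + \<beta>) \<xi>"
    proof (cases "\<xi> \<in> ?A")
      case True
      then show ?thesis using i by (simp add: ennreal_neg)
    next
      case False
      have "e2ennreal (ereal (a i x \<bullet> \<xi> - b i x) + 0) \<le> ennreal (a i x \<bullet> \<xi> - (b i x + \<beta>)) + ennreal \<beta>"
        using e2ennreal_add_le[of "ereal (a i x \<bullet> \<xi> - b i x)" "ereal (a i x \<bullet> \<xi> - (b i x + \<beta>))" \<beta>] \<beta> by simp
      also have "\<dots> \<le> affine_loss {1..I} (\<lambda>i. a i x) (\<lambda>i. b i x + \<beta>) \<xi> + ennreal \<beta>"
        using affine_loss_ge[OF J(1) i, of "\<lambda>i. a i x" \<xi> "\<lambda>i. b i x + \<beta>"] by (intro add_right_mono)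
      finally show ?thesis using False by (simp add: add.commute)
    qed
  qed
  then have "(\<integral>\<^sup>+\<xi>. affine_loss {1..I} (\<lambda>i. a i x) (\<lambda>i. b i x) \<xi> \<partial>P)
    \<le> (\<integral>\<^sup>+\<xi>. ennreal \<beta> * indicator (- ?A) \<xi> + affine_loss {1..I} (\<lambda>i. a i x) (\<lambda>i. b i x + \<beta>) \<xi> \<partial>P)"
    by (intro nn_integral_mono)
  also have "\<dots> = ennreal \<beta> * emeasure P (- ?A) + (\<integral>\<^sup>+\<xi>. affine_loss {1..I} (\<lambda>i. a i x) (\<lambda>i. b i x + \<beta>) \<xi> \<partial>P)"
    by (subst nn_integral_add) (auto simp: nn_integral_cmult_indicator space Compl_eq_Diff_UNIV)
  also have "ennreal \<beta> * emeasure P (- ?A) \<le> ennreal (\<epsilon> * \<beta>)"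
    using mult_left_mono[OF viol, of "ennreal \<beta>"] \<beta> e by (simp add: ennreal_mult mult.commute)
  finally show ?thesis by (simp add: add_right_mono)
qed

text \<open>Couplings by two shifts: a coin with bias \<open>p\<close> that is independent of \<open>z\<close> decides whether \<open>z\<close> is
  moved by \<open>T1 z\<close> or by \<open>T2 z\<close>. Randomizing between two deterministic transports is all that is needed
  to use up a transport budget exactly.\<close>
lemma mixed_shift_coupling:
  fixes T1 T2 :: "'a::euclidean_space \<Rightarrow> 'a"
  assumes P0: "borel_prob P0"
    and [measurable]: "T1 \<in> borel_measurable borel" "T2 \<in> borel_measurable borel"
    and p: "0 \<le> p" "p \<le> 1"
  obtains Q P where "Q \<in> couplings P P0"
    and "\<forall>f\<in>borel_measurable (borel \<Otimes>\<^sub>M borel). (\<integral>\<^sup>+x. f x \<partial>Q) =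
      ennreal p * (\<integral>\<^sup>+z. f (z + T1 z, z) \<partial>P0) + ennreal (1 - p) * (\<integral>\<^sup>+z. f (z + T2 z, z) \<partial>P0)"
    and "\<forall>f\<in>borel_measurable borel. (\<integral>\<^sup>+\<xi>. f \<xi> \<partial>P) =
      ennreal p * (\<integral>\<^sup>+z. f (z + T1 z) \<partial>P0) + ennreal (1 - p) * (\<integral>\<^sup>+z. f (z + T2 z) \<partial>P0)"
proof -
  define B where "B = measure_pmf (bernoulli_pmf p)"
  define M where "M = P0 \<Otimes>\<^sub>M B"
  define G :: "'a \<times> bool \<Rightarrow> 'a \<times> 'a" where
    "G = (\<lambda>(z, c). (z + (if c then T1 z else T2 z), z))"
  define Q where "Q = distr M (borel \<Otimes>\<^sub>M borel) G"
  define P where "P = distr Q borel fst"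
  from P0 have "prob_space P0" and [measurable_cong]: "sets P0 = sets borel"
    by (auto simp: borel_prob_def)
  interpret P0: prob_space P0 by fact
  interpret B: prob_space B unfolding B_def by (rule measure_pmf.prob_space_axioms)
  interpret pair_prob_space P0 B ..
  have [measurable_cong]: "sets B = sets (count_space UNIV)" by (simp add: B_def)
  have G [measurable]: "G \<in> M \<rightarrow>\<^sub>M borel \<Otimes>\<^sub>M borel"
    unfolding G_def M_def by measurable
  have prob: "prob_space M" unfolding M_def by (rule P.prob_space_axioms)
  have int: "(\<integral>\<^sup>+x. f x \<partial>Q) =
      ennreal p * (\<integral>\<^sup>+z. f (z + T1 z, z) \<partial>P0) + ennreal (1 - p) * (\<integral>\<^sup>+z. f (z + T2 z, z) \<partial>P0)"
    if [measurable]: "f \<in> borel_measurable (borel \<Otimes>\<^sub>M borel)" for f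
  proof -
    have [measurable]: "(\<lambda>x. f (G x)) \<in> borel_measurable (P0 \<Otimes>\<^sub>M B)"
      unfolding M_def[symmetric] by measurable
    have "(\<integral>\<^sup>+x. f x \<partial>Q) = (\<integral>\<^sup>+x. f (G x) \<partial>M)" unfolding Q_def by (rule nn_integral_distr) measurable
    also have "\<dots> = (\<integral>\<^sup>+z. \<integral>\<^sup>+c. f (G (z, c)) \<partial>B \<partial>P0)"
      unfolding M_def by (rule B.nn_integral_fst[symmetric]) measurable
    also have "\<dots> = (\<integral>\<^sup>+z. ennreal p * f (z + T1 z, z) + ennreal (1 - p) * f (z + T2 z, z) \<partial>P0)"
      using p by (simp add: B_def G_def mult.commute)
    also have "\<dots> = ennreal p * (\<integral>\<^sup>+z. f (z + T1 z, z) \<partial>P0) + ennreal (1 - p) * (\<integral>\<^sup>+z. f (z + T2 z, z) \<partial>P0)"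
      by (subst nn_integral_add) (auto simp: nn_integral_cmult)
    finally show ?thesis .
  qed
  have Qsets: "sets Q = sets (borel \<Otimes>\<^sub>M borel)" by (simp add: Q_def)
  have "distr Q borel snd = distr M borel fst"
  proof -
    have "snd \<circ> G = fst" by (auto simp: G_def)
    then show ?thesis unfolding Q_def using distr_distr[OF measurable_snd G] by simp
  qed
  also have "\<dots> = distr M P0 fst"
    by (rule distr_cong) (auto simp: \<open>sets P0 = sets borel\<close>)
  also have "\<dots> = P0" unfolding M_def by (rule B.distr_pair_fst)
  finally have "Q \<in> couplings P P0"
    using prob by (auto simp: couplings_def P_def Q_def intro!: prob_space.prob_space_distr)
  moreover have "(\<integral>\<^sup>+\<xi>. f \<xi> \<partial>P) =
      ennreal p * (\<integral>\<^sup>+z. f (z + T1 z) \<partial>P0) + ennreal (1 - p) * (\<integral>\<^sup>+z. f (z + T2 z) \<partial>P0)"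
    if [measurable]: "f \<in> borel_measurable borel" for f
  proof -
    have "(\<integral>\<^sup>+\<xi>. f \<xi> \<partial>P) = (\<integral>\<^sup>+x. f (fst x) \<partial>Q)"
      unfolding P_def by (rule nn_integral_distr) (use Qsets in measurable)
    then show ?thesis by (simp add: int)
  qed
  ultimately show ?thesis using int that by blast
qed

section \<open>Strong duality\<close>

lemma affine_loss_bound_mixed_shifts:
  fixes N :: "'a::euclidean_space \<Rightarrow> real" and T1 T2 :: "'a \<Rightarrow> 'a"
  assumes N: "is_norm N" and P0: "borel_prob P0" and J: "finite J"
    and bound: "\<And>P Q. Q \<in> couplings P P0 \<Longrightarrow> transport_cost N q Q \<le> s \<Longrightarrow>
      (\<integral>\<^sup>+\<xi>. affine_loss J u w \<xi> \<partial>P) \<le> S"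
    and T: "T1 \<in> borel_measurable borel" "T2 \<in> borel_measurable borel"
    and p: "0 \<le> p" "p \<le> 1"
    and cost: "ennreal p * (\<integral>\<^sup>+z. ennreal (N (T1 z) powr q) \<partial>P0)
      + ennreal (1 - p) * (\<integral>\<^sup>+z. ennreal (N (T2 z) powr q) \<partial>P0) \<le> s"
  shows "ennreal p * (\<integral>\<^sup>+z. affine_loss J u w (z + T1 z) \<partial>P0)
      + ennreal (1 - p) * (\<integral>\<^sup>+z. affine_loss J u w (z + T2 z) \<partial>P0) \<le> S"
proof -
  note [measurable] = borel_measurable_is_norm[OF N]
  obtain Q P where PQ: "Q \<in> couplings P P0"
    "\<forall>f\<in>borel_measurable (borel \<Otimes>\<^sub>M borel). (\<integral>\<^sup>+x. f x \<partial>Q) =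
      ennreal p * (\<integral>\<^sup>+z. f (z + T1 z, z) \<partial>P0) + ennreal (1 - p) * (\<integral>\<^sup>+z. f (z + T2 z, z) \<partial>P0)"
    "\<forall>f\<in>borel_measurable borel. (\<integral>\<^sup>+\<xi>. f \<xi> \<partial>P) =
      ennreal p * (\<integral>\<^sup>+z. f (z + T1 z) \<partial>P0) + ennreal (1 - p) * (\<integral>\<^sup>+z. f (z + T2 z) \<partial>P0)"
    by (rule mixed_shift_coupling[OF P0 T p])
  have "(\<lambda>(\<xi>1, \<xi>2). ennreal (N (\<xi>1 - \<xi>2) powr q)) \<in> borel_measurable (borel \<Otimes>\<^sub>M borel)"
    by measurable
  from bspec[OF PQ(2) this] cost have "transport_cost N q Q \<le> s"
    by (simp add: transport_cost_def)
  from bound[OF PQ(1) this] show ?thesis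
    by (simp only: bspec[OF PQ(3) borel_measurable_robust_loss[OF J]])
qed

lemma affine_loss_bound_shift:
  fixes N :: "'a::euclidean_space \<Rightarrow> real" and T :: "'a \<Rightarrow> 'a"
  assumes N: "is_norm N" and P0: "borel_prob P0" and J: "finite J"
    and bound: "\<And>P Q. Q \<in> couplings P P0 \<Longrightarrow> transport_cost N q Q \<le> s \<Longrightarrow>
      (\<integral>\<^sup>+\<xi>. affine_loss J u w \<xi> \<partial>P) \<le> S"
    and T: "T \<in> borel_measurable borel"
    and cost: "(\<integral>\<^sup>+z. ennreal (N (T z) powr q) \<partial>P0) \<le> s"
  shows "(\<integral>\<^sup>+z. affine_loss J u w (z + T z) \<partial>P0) \<le> S"
  using affine_loss_bound_mixed_shifts[OF N P0 J bound T T, where p = 1 and q = q] cost by simp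

text \<open>For \<open>q > 1\<close> and a positive price \<open>l\<close>, weak duality is tight pointwise: moving \<open>z\<close> in the steepest
  direction of a maximizing index \<open>i\<close>, by its optimal radius, recovers the robust loss plus the cost.
  Where the robust loss vanishes the point stays, since moving it would cost without any gain.\<close>
lemma optimal_shift:
  fixes N :: "'a::euclidean_space \<Rightarrow> real" and J :: "nat set"
  assumes N: "is_norm N" and q: "1 < q" and l: "0 < l" and J: "finite J" "J \<noteq> {}"
  obtains T where "T \<in> borel_measurable borel"
    and "\<And>z. robust_loss J u w (\<lambda>i. penalty N q (u i) l) z + ennreal (l * N (T z) powr q)
      \<le> affine_loss J u w (z + T z)"
    and "\<And>z. N (T z) = 0 \<or> (\<exists>i\<in>J. N (T z) \<le> optimal_radius q (dual_norm N (u i)) l)"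
proof -
  define r where "r i = optimal_radius q (dual_norm N (u i)) l" for i
  define f where "f i z = u i \<bullet> z - w i + (dual_norm N (u i) * r i - l * r i powr q)" for i z
  have r0: "0 \<le> r i" for i by (simp add: r_def optimal_radius_def)
  have "\<forall>i. \<exists>v. N v \<le> 1 \<and> u i \<bullet> v = dual_norm N (u i)"
    by (metis dual_norm_attained[OF N])
  then obtain v where v: "\<And>i. N (v i) \<le> 1" "\<And>i. u i \<bullet> v i = dual_norm N (u i)" by metis
  \<comment> \<open>The least maximizing index depends measurably on \<open>z\<close>.\<close>
  define sel where "sel z = (LEAST i. i \<in> J \<and> (\<forall>j\<in>J. f j z \<le> f i z))" for z
  define T where "T z = (if 0 < f (sel z) z then r (sel z) *\<^sub>R v (sel z) else 0)" for z
  have f_meas [measurable]: "f i \<in> borel_measurable borel" for i unfolding f_def by measurable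
  have [measurable]: "sel \<in> borel \<rightarrow>\<^sub>M count_space UNIV"
    unfolding sel_def using J(1) by measurable
  have T_meas: "T \<in> borel_measurable borel"
    unfolding T_def by measurable
  have sel: "sel z \<in> J" "\<And>j. j \<in> J \<Longrightarrow> f j z \<le> f (sel z) z" for z
  proof -
    have "Max ((\<lambda>j. f j z) ` J) \<in> (\<lambda>j. f j z) ` J" using J by (intro Max_in) auto
    then obtain i where i: "i \<in> J" "f i z = Max ((\<lambda>j. f j z) ` J)" by force
    then have "i \<in> J \<and> (\<forall>j\<in>J. f j z \<le> f i z)" using J(1) by simp
    then have "sel z \<in> J \<and> (\<forall>j\<in>J. f j z \<le> f (sel z) z)" unfolding sel_def by (rule LeastI)
    then show "sel z \<in> J" "\<And>j. j \<in> J \<Longrightarrow> f j z \<le> f (sel z) z" by auto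
  qed
  have pen: "penalty N q (u i) l = ereal (dual_norm N (u i) * r i - l * r i powr q)" for i
    using penalty_eq_value_at_optimal_radius[OF N q l] by (simp add: r_def)
  have le: "robust_loss J u w (\<lambda>i. penalty N q (u i) l) z \<le> ennreal (f (sel z) z)" for z
    using sel by (intro robust_loss_le J) (simp add: pen flip: f_def, intro ennreal_leI, auto)
  have N_T: "N (r i *\<^sub>R v i) \<le> r i" for i
    using v(1)[of i] r0[of i] by (simp add: is_norm_scaleR[OF N] mult_left_le)
  show thesis
  proof (rule that[OF T_meas])
    fix z
    let ?i = "sel z"
    show "robust_loss J u w (\<lambda>i. penalty N q (u i) l) z + ennreal (l * N (T z) powr q)
      \<le> affine_loss J u w (z + T z)"
    proof (cases "0 < f ?i z")
      case False
      then have "robust_loss J u w (\<lambda>i. penalty N q (u i) l) z = 0"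
        using le[of z] by (simp add: ennreal_neg)
      then show ?thesis using False by (simp add: T_def is_norm_zero[OF N])
    next
      case True
      have "N (T z) powr q \<le> r ?i powr q"
        using True N_T q by (auto simp: T_def intro!: powr_mono2 is_norm_nonneg[OF N])
      then have "robust_loss J u w (\<lambda>i. penalty N q (u i) l) z + ennreal (l * N (T z) powr q)
        \<le> ennreal (f ?i z) + ennreal (l * r ?i powr q)"
        using l by (intro add_mono le ennreal_leI) simp
      also have "\<dots> = ennreal (u ?i \<bullet> (z + T z) - w ?i)"
        using True l by (simp add: T_def f_def v inner_add_right algebra_simps flip: ennreal_plus)
      also have "\<dots> \<le> affine_loss J u w (z + T z)"
        by (intro affine_loss_ge J sel)
      finally show ?thesis .
    qed
    show "N (T z) = 0 \<or> (\<exists>i\<in>J. N (T z) \<le> optimal_radius q (dual_norm N (u i)) l)"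
      using sel(1) N_T by (auto simp: T_def is_norm_zero[OF N] r_def)
  qed
qed

text \<open>For \<open>q = 1\<close> the price \<open>A\<close>, the largest dual norm, makes all penalties vanish, and the claim says that
  the budget \<open>\<theta>\<close> can raise the expected loss by \<open>A * \<theta>\<close> up to an arbitrarily small error. A
  small fraction \<open>\<delta>\<close> of the mass is moved very far in the steepest direction: the raise is linear in the
  cost, and the error is what the moved fraction contributed before the move, and this vanishes with \<open>\<delta>\<close>.\<close>
lemma strong_duality_q_eq_1:
  fixes N :: "'a::euclidean_space \<Rightarrow> real" and J :: "nat set"
  assumes N: "is_norm N" and P0: "borel_prob P0" and J: "finite J" "J \<noteq> {}" and \<theta>: "0 \<le> \<theta>"
    and bound: "\<And>P Q. Q \<in> couplings P P0 \<Longrightarrow> transport_cost N 1 Q \<le> ennreal \<theta> \<Longrightarrow>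
      (\<integral>\<^sup>+\<xi>. affine_loss J u w \<xi> \<partial>P) \<le> S"
    and \<eta>: "0 < \<eta>"
  shows "\<exists>l\<ge>0. ennreal (l * \<theta>) + (\<integral>\<^sup>+z. robust_loss J u w (\<lambda>i. penalty N 1 (u i) l) z \<partial>P0)
    \<le> S + ennreal \<eta>"
proof -
  from P0 have "prob_space P0" and sets[measurable_cong]: "sets P0 = sets borel"
    by (auto simp: borel_prob_def)
  interpret prob_space P0 by fact
  note [measurable] = borel_measurable_is_norm[OF N]
  have space: "space P0 = UNIV" using sets_eq_imp_space_eq[OF sets] by simp
  define A where "A = Max ((\<lambda>i. dual_norm N (u i)) ` J)"
  have "A \<in> (\<lambda>i. dual_norm N (u i)) ` J" unfolding A_def using J by (intro Max_in) auto
  then obtain k where k: "k \<in> J" "A = dual_norm N (u k)" by auto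
  have A: "0 \<le> A" by (simp add: k dual_norm_nonneg[OF N])
  obtain v where v: "N v \<le> 1" "u k \<bullet> v = A" using dual_norm_attained[OF N] k by metis
  define F where "F = (\<integral>\<^sup>+z. affine_loss J u w z \<partial>P0)"
  have "robust_loss J u w (\<lambda>i. penalty N 1 (u i) A) = affine_loss J u w"
    unfolding robust_loss_def penalty_def A_def using J
    by (intro ext arg_cong[where f = Max] image_cong) auto
  moreover have "ennreal (A * \<theta>) + F \<le> S + ennreal \<eta>"
  proof (cases "S = top")
    case True then show ?thesis by simp
  next
    case False
    then obtain s where s: "S = ennreal s" "0 \<le> s" by (cases S) auto
    have "F \<le> S"
      using affine_loss_bound_shift[OF N P0 J(1) bound, where T = "\<lambda>_. 0"] by (simp add: F_def is_norm_zero[OF N])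
    then obtain f where f: "F = ennreal f" "0 \<le> f" using s by (cases F) (auto simp: top_unique)
    \<comment> \<open>Only points at which the steepest function is not too negative are moved, so that this
      function, rather than its truncation at zero, collects the whole raise.\<close>
    define B where "B n = {z. - real n \<le> u k \<bullet> z - w k}" for n :: nat
    have B[measurable]: "B n \<in> sets P0" for n unfolding B_def by measurable
    have "\<exists>n. emeasure P0 (B n) \<noteq> 0"
    proof (rule ccontr)
      assume "\<nexists>n. emeasure P0 (B n) \<noteq> 0"
      then have "emeasure P0 (\<Union>n. B n) = 0" by (intro emeasure_UN_eq_0) auto
      moreover have "(\<Union>n. B n) = UNIV"
      proof (intro equalityI subsetI UNIV_I)
        fix z :: 'a
        obtain n where "- (u k \<bullet> z - w k) \<le> real n" using real_arch_simple by blast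
        then show "z \<in> (\<Union>n. B n)" by (auto simp: B_def intro!: exI[of _ n])
      qed
      ultimately show False using emeasure_space_1 by (simp add: space)
    qed
    then obtain n where n: "emeasure P0 (B n) \<noteq> 0" by blast
    define m where "m = prob (B n)"
    have m: "0 < m" "m \<le> 1" "emeasure P0 (B n) = ennreal m"
      using n by (auto simp: m_def emeasure_eq_measure zero_less_measure_iff)
    define \<delta> where "\<delta> = min 1 (\<eta> / (f + real n + 1))"
    have \<delta>: "0 < \<delta>" "\<delta> \<le> 1" "\<delta> * (f + real n) \<le> \<eta>"
    proof -
      show "0 < \<delta>" "\<delta> \<le> 1" using \<eta> f by (auto simp: \<delta>_def)
      have "\<delta> * (f + real n) \<le> \<eta> / (f + real n + 1) * (f + real n)"
        using f by (intro mult_right_mono) (auto simp: \<delta>_def)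
      also have "\<dots> \<le> \<eta>" using \<eta> f by (simp add: field_simps)
      finally show "\<delta> * (f + real n) \<le> \<eta>" .
    qed
    \<comment> \<open>The largest distance that the budget allows: \<open>\<theta>\<close> spread over the moved mass \<open>\<delta> * m\<close>.\<close>
    define \<rho> where "\<rho> = \<theta> / (\<delta> * m)"
    have \<rho>: "0 \<le> \<rho>" "\<delta> * (\<rho> * m) = \<theta>" using \<theta> \<delta> m by (auto simp: \<rho>_def)
    define T where "T z = (if z \<in> B n then \<rho> *\<^sub>R v else 0)" for z
    have [measurable]: "T \<in> borel_measurable borel" unfolding T_def B_def by measurable
    have "(\<integral>\<^sup>+z. ennreal (N (T z) powr 1) \<partial>P0) \<le> (\<integral>\<^sup>+z. ennreal \<rho> * indicator (B n) z \<partial>P0)"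
      using v(1) \<rho> by (intro nn_integral_mono)
        (auto simp: T_def is_norm_scaleR[OF N] is_norm_zero[OF N] is_norm_nonneg[OF N] indicator_def mult_left_le intro!: ennreal_leI)
    also have "\<dots> = ennreal (\<rho> * m)"
      using \<rho> m by (simp add: nn_integral_cmult_indicator ennreal_mult)
    finally have "ennreal \<delta> * (\<integral>\<^sup>+z. ennreal (N (T z) powr 1) \<partial>P0) \<le> ennreal \<delta> * ennreal (\<rho> * m)"
      by (intro mult_left_mono) auto
    then have "ennreal \<delta> * (\<integral>\<^sup>+z. ennreal (N (T z) powr 1) \<partial>P0) \<le> ennreal \<theta>"
      using \<delta> \<rho> m by (simp flip: ennreal_mult)
    then have total: "ennreal \<delta> * (\<integral>\<^sup>+z. affine_loss J u w (z + T z) \<partial>P0) + ennreal (1 - \<delta>) * F \<le> S"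
      using affine_loss_bound_mixed_shifts[OF N P0 J(1) bound, where ?T1.0 = T and ?T2.0 = "\<lambda>_. 0" and p = \<delta>] \<delta>
      by (simp add: F_def is_norm_zero[OF N])
    have "ennreal (A * \<rho> - real n) * ennreal m = (\<integral>\<^sup>+z. ennreal (A * \<rho> - real n) * indicator (B n) z \<partial>P0)"
      using m by (simp add: nn_integral_cmult_indicator)
    also have "\<dots> \<le> (\<integral>\<^sup>+z. affine_loss J u w (z + T z) \<partial>P0)"
    proof (intro nn_integral_mono)
      fix z
      show "ennreal (A * \<rho> - real n) * indicator (B n) z \<le> affine_loss J u w (z + T z)"
      proof (cases "z \<in> B n")
        case True
        then have "ennreal (A * \<rho> - real n) \<le> ennreal (u k \<bullet> (z + T z) - w k)"
          by (intro ennreal_leI) (auto simp: T_def B_def inner_add_right v algebra_simps)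
        also have "\<dots> \<le> affine_loss J u w (z + T z)" by (intro affine_loss_ge J k)
        finally show ?thesis using True by simp
      qed simp
    qed
    finally have "ennreal \<delta> * (ennreal (A * \<rho> - real n) * ennreal m) + ennreal (1 - \<delta>) * F \<le> S"
      using total by (meson add_right_mono mult_left_mono order.trans zero_le)
    moreover have "ennreal \<delta> * (ennreal (A * \<rho> - real n) * ennreal m) = ennreal (A * \<theta> - \<delta> * m * n)"
    proof -
      have "\<delta> * ((A * \<rho> - real n) * m) = A * (\<delta> * (\<rho> * m)) - \<delta> * m * n" by (simp add: algebra_simps)
      then show ?thesis using \<delta> m by (simp add: \<rho> flip: ennreal_mult' ennreal_mult'')
    qed
    ultimately have "ennreal (A * \<theta> - \<delta> * m * n) + ennreal ((1 - \<delta>) * f) \<le> ennreal s"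
      using f s \<delta> by (simp add: ennreal_mult)
    moreover have "ennreal (A * \<theta> - \<delta> * m * n + (1 - \<delta>) * f) \<le> ennreal (A * \<theta> - \<delta> * m * n) + ennreal ((1 - \<delta>) * f)"
      using f \<delta> by (cases "0 \<le> A * \<theta> - \<delta> * m * n") (auto simp: ennreal_neg intro!: ennreal_leI)
    ultimately have "A * \<theta> - \<delta> * m * n + (1 - \<delta>) * f \<le> s"
      using s(2) by (meson ennreal_le_iff order.trans)
    moreover have "\<delta> * m * n \<le> \<delta> * n"
      using \<delta> m by (intro mult_right_mono) (auto simp: mult_left_le)
    ultimately have "A * \<theta> + f \<le> s + \<eta>" using \<delta>(3) by (simp add: algebra_simps)
    then show ?thesis using A \<theta> f s \<eta> by (simp flip: ennreal_plus)
  qed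
  ultimately show ?thesis using A unfolding F_def by metis
qed

lemma optimal_radius_eventually_small:
  fixes D :: "nat \<Rightarrow> real"
  assumes q: "1 < q" and \<rho>: "0 < \<rho>" and D: "\<And>i. 0 \<le> D i" and J: "finite J"
  obtains L where "0 < L" "\<And>l i. L \<le> l \<Longrightarrow> i \<in> J \<Longrightarrow> optimal_radius q (D i) l \<le> \<rho>"
proof
  let ?L = "1 + (\<Sum>i\<in>J. D i / (q * \<rho> powr (q - 1)))"
  have nn: "0 \<le> D i / (q * \<rho> powr (q - 1))" for i using D q by simp
  then have s: "0 \<le> (\<Sum>i\<in>J. D i / (q * \<rho> powr (q - 1)))" by (intro sum_nonneg)
  then show "0 < ?L" by simp
  fix l i assume l: "?L \<le> l" and i: "i \<in> J"
  have "D i / (q * \<rho> powr (q - 1)) \<le> (\<Sum>i\<in>J. D i / (q * \<rho> powr (q - 1)))"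
    using nn J i by (intro member_le_sum) auto
  then show "optimal_radius q (D i) l \<le> \<rho>"
    using l s by (intro optimal_radius_small q \<rho> D) auto
qed

text \<open>With no budget only the reference distribution is left, and the price \<open>l\<close> is free of charge. The
  penalties tend to zero as \<open>l\<close> grows, but they may be positive for every \<open>l\<close>, hence the error \<open>\<eta>\<close>.\<close>
lemma strong_duality_radius_0:
  fixes N :: "'a::euclidean_space \<Rightarrow> real" and J :: "nat set"
  assumes N: "is_norm N" and q: "1 < q" and P0: "borel_prob P0" and J: "finite J" "J \<noteq> {}"
    and \<eta>: "0 < \<eta>"
  shows "\<exists>l\<ge>0. (\<integral>\<^sup>+z. robust_loss J u w (\<lambda>i. penalty N q (u i) l) z \<partial>P0)
    \<le> (\<integral>\<^sup>+z. affine_loss J u w z \<partial>P0) + ennreal \<eta>"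
proof -
  from P0 have "prob_space P0" and [measurable_cong]: "sets P0 = sets borel"
    by (auto simp: borel_prob_def)
  interpret prob_space P0 by fact
  define D where "D i = dual_norm N (u i)" for i
  have D: "0 \<le> D i" for i by (simp add: D_def dual_norm_nonneg[OF N])
  define \<rho> where "\<rho> = \<eta> / (1 + (\<Sum>i\<in>J. D i))"
  have sum: "0 \<le> (\<Sum>i\<in>J. D i)" using D by (intro sum_nonneg)
  then have \<rho>: "0 < \<rho>" using \<eta> by (simp add: \<rho>_def)
  from optimal_radius_eventually_small[where D = D and J = J, OF q \<rho> D J(1)]
  obtain l where l: "0 < l" "\<And>i. i \<in> J \<Longrightarrow> optimal_radius q (D i) l \<le> \<rho>"
    by (metis order.refl)
  have "robust_loss J u w (\<lambda>i. penalty N q (u i) l) z \<le> affine_loss J u w z + ennreal \<eta>" for z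
  proof (rule robust_loss_le[OF J])
    fix i assume i: "i \<in> J"
    define r where "r = optimal_radius q (D i) l"
    have "D i * r - l * r powr q \<le> D i * r" using l by simp
    also have "\<dots> \<le> D i * \<rho>" using D l(2)[OF i] by (intro mult_left_mono) (auto simp: r_def)
    also have "\<dots> \<le> (1 + (\<Sum>i\<in>J. D i)) * \<rho>"
      using D \<rho> J i member_le_sum[of i J D] by (intro mult_right_mono) auto
    also have "\<dots> = \<eta>" using sum by (simp add: \<rho>_def)
    finally have "penalty N q (u i) l \<le> ereal \<eta>"
      using penalty_eq_value_at_optimal_radius[OF N q l(1), of "u i"] by (simp add: r_def D_def)
    then have "e2ennreal (ereal (u i \<bullet> z - w i) + penalty N q (u i) l) \<le> e2ennreal (ereal (u i \<bullet> z - w i)) + ennreal \<eta>"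
      using \<eta> by (intro e2ennreal_add_le add_left_mono) auto
    also have "\<dots> \<le> affine_loss J u w z + ennreal \<eta>"
      using affine_loss_ge[OF J(1) i, of u z w] by (intro add_right_mono) simp
    finally show "e2ennreal (ereal (u i \<bullet> z - w i) + penalty N q (u i) l) \<le> affine_loss J u w z + ennreal \<eta>" .
  qed
  then have "(\<integral>\<^sup>+z. robust_loss J u w (\<lambda>i. penalty N q (u i) l) z \<partial>P0)
    \<le> (\<integral>\<^sup>+z. affine_loss J u w z + ennreal \<eta> \<partial>P0)"
    by (intro nn_integral_mono)
  also have "\<dots> = (\<integral>\<^sup>+z. affine_loss J u w z \<partial>P0) + ennreal \<eta>"
    using J(1) by (subst nn_integral_add) (auto simp: emeasure_space_1)
  finally show ?thesis using l(1) by (intro exI[of _ l]) simp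
qed

text \<open>The optimal shifts \<open>T l\<close> attain the robust loss plus \<open>l\<close> times their cost \<open>C l\<close>, so a transport whose
  cost is exactly the budget \<open>s\<close> would attain the dual value at \<open>l\<close>. The cost may jump across the
  budget as \<open>l\<close> varies, when ties between indices are broken differently; therefore two neighbouring
  prices on a fine grid are used, the shift for the lower one exceeding the budget and the shift for the
  higher one respecting it, and the two are mixed so that the budget is met exactly. The error
  is at most the grid width times \<open>s\<close>. If already the first grid point respects the budget, then its price is so small that the
  dual budget term \<open>l * s\<close> is negligible.\<close>
lemma strong_duality_q_gt_1:
  fixes N :: "'a::euclidean_space \<Rightarrow> real" and J :: "nat set"
  assumes N: "is_norm N" and q: "1 < q" and P0: "borel_prob P0" and J: "finite J" "J \<noteq> {}" and \<theta>: "0 < \<theta>"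
    and bound: "\<And>P Q. Q \<in> couplings P P0 \<Longrightarrow> transport_cost N q Q \<le> ennreal (\<theta> powr q) \<Longrightarrow>
      (\<integral>\<^sup>+\<xi>. affine_loss J u w \<xi> \<partial>P) \<le> S"
    and \<eta>: "0 < \<eta>"
  shows "\<exists>l\<ge>0. ennreal (l * \<theta> powr q) + (\<integral>\<^sup>+z. robust_loss J u w (\<lambda>i. penalty N q (u i) l) z \<partial>P0)
    \<le> S + ennreal \<eta>"
proof -
  from P0 have "prob_space P0" and [measurable_cong]: "sets P0 = sets borel"
    by (auto simp: borel_prob_def)
  interpret prob_space P0 by fact
  note [measurable] = borel_measurable_is_norm[OF N] and [simp] = J(1)
  define s where "s = \<theta> powr q"
  have s: "0 < s" using \<theta> by (simp add: s_def)
  define D where "D i = dual_norm N (u i)" for i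
  have D: "0 \<le> D i" for i by (simp add: D_def dual_norm_nonneg[OF N])
  define H where "H l = (\<integral>\<^sup>+z. robust_loss J u w (\<lambda>i. penalty N q (u i) l) z \<partial>P0)" for l
  have "\<forall>l. \<exists>T. 0 < l \<longrightarrow> T \<in> borel_measurable borel \<and>
    (\<forall>z. robust_loss J u w (\<lambda>i. penalty N q (u i) l) z + ennreal (l * N (T z) powr q)
      \<le> affine_loss J u w (z + T z)) \<and>
    (\<forall>z. N (T z) = 0 \<or> (\<exists>i\<in>J. N (T z) \<le> optimal_radius q (D i) l))"
    unfolding D_def using optimal_shift[OF N q _ J] by metis
  then obtain T where T: "\<And>l. 0 < l \<Longrightarrow> T l \<in> borel_measurable borel"
    "\<And>l z. 0 < l \<Longrightarrow> robust_loss J u w (\<lambda>i. penalty N q (u i) l) z + ennreal (l * N (T l z) powr q)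
      \<le> affine_loss J u w (z + T l z)"
    "\<And>l z. 0 < l \<Longrightarrow> N (T l z) = 0 \<or> (\<exists>i\<in>J. N (T l z) \<le> optimal_radius q (D i) l)"
    by metis
  define C where "C l = (\<integral>\<^sup>+z. ennreal (N (T l z) powr q) \<partial>P0)" for l
  define V where "V l = (\<integral>\<^sup>+z. affine_loss J u w (z + T l z) \<partial>P0)" for l
  have V: "H l + ennreal l * C l \<le> V l" if l: "0 < l" for l
  proof -
    note [measurable] = T(1)[OF l]
    have "H l + ennreal l * C l = (\<integral>\<^sup>+z. robust_loss J u w (\<lambda>i. penalty N q (u i) l) z + ennreal (l * N (T l z) powr q) \<partial>P0)"
      using l by (simp add: H_def C_def nn_integral_add ennreal_mult' nn_integral_cmult)
    also have "\<dots> \<le> V l" unfolding V_def by (intro nn_integral_mono T l)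
    finally show ?thesis .
  qed
  have C_le: "C l \<le> ennreal (\<rho> powr q)" if l: "0 < l" and \<rho>: "0 \<le> \<rho>" "\<And>i. i \<in> J \<Longrightarrow> optimal_radius q (D i) l \<le> \<rho>" for l \<rho>
  proof -
    have "N (T l z) \<le> \<rho>" for z using T(3)[OF l, of z] \<rho> by (metis order.trans)
    then have "C l \<le> (\<integral>\<^sup>+z. ennreal (\<rho> powr q) \<partial>P0)"
      unfolding C_def using q by (intro nn_integral_mono ennreal_leI powr_mono2 is_norm_nonneg[OF N]) auto
    then show ?thesis by (simp add: emeasure_space_1)
  qed
  have C_finite: "C l < top" if l: "0 < l" for l
  proof -
    have "optimal_radius q (D i) l \<le> (\<Sum>i\<in>J. optimal_radius q (D i) l)" if "i \<in> J" for i
      using that by (intro member_le_sum) (auto simp: optimal_radius_def)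
    then have "C l \<le> ennreal ((\<Sum>i\<in>J. optimal_radius q (D i) l) powr q)"
      by (intro C_le l sum_nonneg) (auto simp: optimal_radius_def)
    then show ?thesis by (rule order.strict_trans1) simp
  qed
  \<comment> \<open>The grid width: a price change of \<open>\<kappa>\<close> changes the dual budget term by exactly \<open>\<eta>\<close>.\<close>
  define \<kappa> where "\<kappa> = \<eta> / s"
  have \<kappa>: "0 < \<kappa>" "\<kappa> * s = \<eta>" using s \<eta> by (auto simp: \<kappa>_def)
  from optimal_radius_eventually_small[where D = D and J = J, OF q \<theta> D J(1)]
  obtain L where L: "0 < L" "\<And>l i. L \<le> l \<Longrightarrow> i \<in> J \<Longrightarrow> optimal_radius q (D i) l \<le> \<theta>" by blast
  \<comment> \<open>The grid starts at \<open>\<kappa>\<close>, as optimal shifts exist for positive prices.\<close>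
  define cheap where "cheap k \<longleftrightarrow> C (real (Suc k) * \<kappa>) \<le> ennreal s" for k
  have "\<exists>k. cheap k"
  proof -
    obtain k :: nat where "L / \<kappa> \<le> real k" using real_arch_simple by blast
    then have "L \<le> real (Suc k) * \<kappa>" using \<kappa> by (simp add: field_simps)
    then have "cheap k" unfolding cheap_def s_def using L \<theta> by (intro C_le) auto
    then show ?thesis ..
  qed
  define k where "k = (LEAST k. cheap k)"
  have k: "cheap k" "\<And>j. j < k \<Longrightarrow> \<not> cheap j"
    using \<open>\<exists>k. cheap k\<close> unfolding k_def by (auto intro: LeastI_ex dest: not_less_Least)
  define l2 where "l2 = real (Suc k) * \<kappa>"
  define l1 where "l1 = real k * \<kappa>"
  have l2: "0 < l2" "C l2 \<le> ennreal s" using k(1) \<kappa> by (auto simp: l2_def cheap_def)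
  have l12: "l2 * s = l1 * s + \<eta>" using \<kappa>(2) by (simp add: l1_def l2_def algebra_simps)
  have "\<exists>l\<ge>0. ennreal (l * s) + H l \<le> S + ennreal \<eta>"
  proof (cases "k = 0")
    case True
    have "H l2 \<le> H l2 + ennreal l2 * C l2" by simp
    also have "\<dots> \<le> V l2" by (rule V) fact
    also have "V l2 \<le> S"
      unfolding V_def using l2 by (intro affine_loss_bound_shift[OF N P0 J(1) bound T(1)]) (auto simp: C_def s_def)
    finally have "H l2 \<le> S" .
    moreover have "l2 * s = \<eta>" using l12 True by (simp add: l1_def)
    ultimately show ?thesis using l2 by (intro exI[of _ l2]) (simp add: add.commute add_left_mono)
  next
    case False
    then obtain j where j: "k = Suc j" by (cases k) auto
    have l1: "0 < l1" "ennreal s < C l1"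
      using False \<kappa> k(2)[of j] by (auto simp: l1_def cheap_def j not_le)
    obtain c1 where c1: "C l1 = ennreal c1" "0 \<le> c1" using C_finite[OF l1(1)] by (cases "C l1") auto
    obtain c2 where c2: "C l2 = ennreal c2" "0 \<le> c2" using C_finite[OF l2(1)] by (cases "C l2") auto
    have c: "s < c1" "c2 \<le> s" using l1(2) l2(2) s c1 c2 by (auto simp: ennreal_less_iff)
    define p where "p = (s - c2) / (c1 - c2)"
    have p: "0 \<le> p" "p \<le> 1" using c by (auto simp: p_def)
    have "p * (c1 - c2) = s - c2" using c by (simp add: p_def)
    then have pc: "p * c1 + (1 - p) * c2 = s" by (simp add: algebra_simps)
    have "ennreal p * C l1 + ennreal (1 - p) * C l2 = ennreal s"
      using p c1 c2 by (simp add: pc flip: ennreal_mult ennreal_plus)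
    then have "ennreal p * V l1 + ennreal (1 - p) * V l2 \<le> S"
      unfolding V_def using l1 l2 p
      by (intro affine_loss_bound_mixed_shifts[OF N P0 J(1) bound T(1) T(1)]) (auto simp: C_def s_def)
    moreover define h where "h = min (H l1) (H l2)"
    have "h + ennreal (l1 * s) \<le> ennreal p * V l1 + ennreal (1 - p) * V l2"
    proof -
      have "ennreal p + ennreal (1 - p) = 1" using p by (simp flip: ennreal_plus)
      then have h: "h = ennreal p * h + ennreal (1 - p) * h" by (metis distrib_right mult_1)
      have "l1 * s = p * (l1 * c1) + (1 - p) * (l1 * c2)" by (simp add: algebra_simps flip: pc)
      also have "\<dots> \<le> p * (l1 * c1) + (1 - p) * (l2 * c2)"
        using p c2 \<kappa> by (intro add_left_mono mult_left_mono mult_right_mono) (auto simp: l1_def l2_def)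
      finally have "ennreal (l1 * s) \<le> ennreal p * (ennreal l1 * C l1) + ennreal (1 - p) * (ennreal l2 * C l2)"
        using p l1 l2 c1 c2 by (simp add: ennreal_leI flip: ennreal_mult ennreal_plus)
      then have "h + ennreal (l1 * s) \<le> (ennreal p * h + ennreal (1 - p) * h)
          + (ennreal p * (ennreal l1 * C l1) + ennreal (1 - p) * (ennreal l2 * C l2))"
        using h by (metis add_left_mono)
      also have "\<dots> = ennreal p * (h + ennreal l1 * C l1) + ennreal (1 - p) * (h + ennreal l2 * C l2)"
        by (simp add: distrib_left ac_simps)
      also have "\<dots> \<le> ennreal p * V l1 + ennreal (1 - p) * V l2"
      proof (intro add_mono mult_left_mono)
        show "h + ennreal l1 * C l1 \<le> V l1"
          using V[OF l1(1)] by (rule order.trans[rotated]) (auto simp: h_def intro: add_right_mono)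
        show "h + ennreal l2 * C l2 \<le> V l2"
          using V[OF l2(1)] by (rule order.trans[rotated]) (auto simp: h_def intro: add_right_mono)
      qed auto
      finally show ?thesis .
    qed
    ultimately have hS: "h + ennreal (l1 * s) \<le> S" by simp
    obtain l where l: "l = l1 \<or> l = l2" "H l = h" unfolding h_def by (metis min_def)
    have "l * s \<le> l2 * s" using l \<eta> l12 by auto
    then have "ennreal (l * s) + H l \<le> ennreal (l1 * s + \<eta>) + h"
      using l by (auto simp: l12 intro!: add_right_mono ennreal_leI)
    also have "\<dots> = (h + ennreal (l1 * s)) + ennreal \<eta>"
      using l1 s \<eta> by (simp add: ac_simps)
    also have "\<dots> \<le> S + ennreal \<eta>" by (intro add_right_mono hS)
    finally show ?thesis using l l1 l2 by (intro exI[of _ l]) auto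
  qed
  then show ?thesis by (simp add: s_def H_def)
qed

text \<open>Every common upper bound \<open>S\<close> of the expected losses over the Wasserstein ball is, up to \<open>\<eta>\<close>, an upper
  bound of the dual value at some price \<open>l\<close>. The error \<open>\<eta>\<close> cannot be avoided because the dual infimum need not
  be attained.\<close>
lemma strong_duality:
  fixes N :: "'a::euclidean_space \<Rightarrow> real" and J :: "nat set"
  assumes N: "is_norm N" and q: "1 \<le> q" and P0: "borel_prob P0" and J: "finite J" "J \<noteq> {}" and \<theta>: "0 \<le> \<theta>"
    and bound: "\<And>P Q. Q \<in> couplings P P0 \<Longrightarrow> transport_cost N q Q \<le> ennreal (\<theta> powr q) \<Longrightarrow>
      (\<integral>\<^sup>+\<xi>. affine_loss J u w \<xi> \<partial>P) \<le> S"
    and \<eta>: "0 < \<eta>"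
  shows "\<exists>l\<ge>0. ennreal (l * \<theta> powr q) + (\<integral>\<^sup>+z. robust_loss J u w (\<lambda>i. penalty N q (u i) l) z \<partial>P0)
    \<le> S + ennreal \<eta>"
proof -
  consider "q = 1" | "q > 1" "\<theta> = 0" | "q > 1" "\<theta> > 0" using q \<theta> by linarith
  then show ?thesis
  proof cases
    case 1
    have "\<exists>l\<ge>0. ennreal (l * \<theta>) + (\<integral>\<^sup>+z. robust_loss J u w (\<lambda>i. penalty N 1 (u i) l) z \<partial>P0)
        \<le> S + ennreal \<eta>"
      by (rule strong_duality_q_eq_1[OF N P0 J \<theta> _ \<eta>]) (rule bound, use 1 \<theta> in simp_all)
    then show ?thesis using 1 \<theta> by simp
  next
    case 2
    have "(\<integral>\<^sup>+z. affine_loss J u w z \<partial>P0) \<le> S"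
      using affine_loss_bound_shift[OF N P0 J(1) bound, where T = "\<lambda>_. 0"] by (simp add: is_norm_zero[OF N])
    moreover obtain l where l: "0 \<le> l"
      "(\<integral>\<^sup>+z. robust_loss J u w (\<lambda>i. penalty N q (u i) l) z \<partial>P0)
        \<le> (\<integral>\<^sup>+z. affine_loss J u w z \<partial>P0) + ennreal \<eta>"
      using strong_duality_radius_0[OF N 2(1) P0 J \<eta>, of u w] by auto
    ultimately have "(\<integral>\<^sup>+z. robust_loss J u w (\<lambda>i. penalty N q (u i) l) z \<partial>P0) \<le> S + ennreal \<eta>"
      by (meson add_right_mono order.trans)
    then show ?thesis using l(1) 2 by (intro exI[of _ l]) simp
  next
    case 3
    show ?thesis by (rule strong_duality_q_gt_1[OF N 3(1) P0 J 3(2) bound \<eta>])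
  qed
qed

section \<open>Comparison of the two approximations\<close>

text \<open>At a feasible \<open>x\<close> the threshold \<open>0\<close> is as good as any \<open>\<beta> \<ge> 0\<close>, once \<open>l\<close> is optimized. The objective at
  \<open>(l, \<beta>)\<close> bounds the expected loss over the Wasserstein ball (by \<open>chance_bound\<close> and \<open>weak_duality\<close>), and
  by \<open>strong_duality\<close> such a bound is nearly reached by the objective at threshold \<open>0\<close>. The lower bound \<open>M\<close>
  stands in for an infimum over \<open>l'\<close> that need not be attained.\<close>
lemma L_obj_zero_le:
  fixes N :: "real^'m \<Rightarrow> real" and P0 :: "(real^'m) measure"
    and a :: "nat \<Rightarrow> real^'n \<Rightarrow> real^'m"
  assumes N: "is_norm N" and P0: "borel_prob P0" and I: "I \<ge> 1" and e: "0 \<le> \<epsilon>" and \<theta>: "0 \<le> \<theta>" and q: "1 \<le> q"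
    and x: "x \<in> dr_feasible N P0 I a b \<epsilon> \<theta> q" and l: "0 \<le> l" and \<beta>: "0 \<le> \<beta>"
    and M: "\<And>l'. 0 \<le> l' \<Longrightarrow> M \<le> L_obj N P0 I a b \<epsilon> \<theta> q x l' 0"
  shows "M \<le> L_obj N P0 I a b \<epsilon> \<theta> q x l \<beta>"
proof -
  have J: "finite {1..I}" "{1..I} \<noteq> {}" using I by auto
  define S where "S = ennreal (\<epsilon> * \<beta> + l * \<theta> powr q) +
    (\<integral>\<^sup>+z. robust_loss {1..I} (\<lambda>i. a i x) (\<lambda>i. b i x + \<beta>) (\<lambda>i. penalty N q (a i x) l) z \<partial>P0)"
  have L: "L_obj N P0 I a b \<epsilon> \<theta> q x l \<beta> = enn2ereal S"
    unfolding S_def using I e l \<beta> by (intro L_obj_eq_robust_loss) auto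
  have bound: "(\<integral>\<^sup>+\<xi>. affine_loss {1..I} (\<lambda>i. a i x) (\<lambda>i. b i x) \<xi> \<partial>P) \<le> S"
    if Q: "Q \<in> couplings P P0" and cost: "transport_cost N q Q \<le> ennreal (\<theta> powr q)" for P Q
  proof -
    have "(\<integral>\<^sup>+\<xi>. affine_loss {1..I} (\<lambda>i. a i x) (\<lambda>i. b i x) \<xi> \<partial>P)
      \<le> ennreal (\<epsilon> * \<beta>) + (\<integral>\<^sup>+\<xi>. affine_loss {1..I} (\<lambda>i. a i x) (\<lambda>i. b i x + \<beta>) \<xi> \<partial>P)"
      by (rule chance_bound[OF I \<beta> e x coupling_in_ambiguity_set[OF Q cost \<theta> q]])
    also have "\<dots> \<le> ennreal (\<epsilon> * \<beta>) + (ennreal (l * \<theta> powr q) +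
      (\<integral>\<^sup>+z. robust_loss {1..I} (\<lambda>i. a i x) (\<lambda>i. b i x + \<beta>) (\<lambda>i. penalty N q (a i x) l) z \<partial>P0))"
      by (intro add_left_mono weak_duality[OF N q l J Q cost]) simp
    also have "\<dots> = S" using e \<beta> l by (simp add: S_def add.assoc)
    finally show ?thesis .
  qed
  have "e2ennreal M \<le> S"
  proof (rule ennreal_le_epsilon)
    fix \<eta> :: real assume "0 < \<eta>"
    have "\<exists>l'\<ge>0. ennreal (l' * \<theta> powr q) + (\<integral>\<^sup>+z. robust_loss {1..I} (\<lambda>i. a i x) (\<lambda>i. b i x)
        (\<lambda>i. penalty N q (a i x) l') z \<partial>P0) \<le> S + ennreal \<eta>"
      by (rule strong_duality[OF N q P0 J \<theta> bound \<open>0 < \<eta>\<close>])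
    then obtain l' where l': "0 \<le> l'"
      "ennreal (l' * \<theta> powr q) + (\<integral>\<^sup>+z. robust_loss {1..I} (\<lambda>i. a i x) (\<lambda>i. b i x)
        (\<lambda>i. penalty N q (a i x) l') z \<partial>P0) \<le> S + ennreal \<eta>" by blast
    have "M \<le> L_obj N P0 I a b \<epsilon> \<theta> q x l' 0" by (rule M) fact
    also have "\<dots> = enn2ereal (ennreal (l' * \<theta> powr q) + (\<integral>\<^sup>+z. robust_loss {1..I} (\<lambda>i. a i x) (\<lambda>i. b i x)
        (\<lambda>i. penalty N q (a i x) l') z \<partial>P0))"
      using L_obj_eq_robust_loss[OF I, of \<epsilon> 0 l' \<theta> q N P0 a b x] l'(1) by simp
    also have "\<dots> \<le> enn2ereal (S + ennreal \<eta>)"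
      using l'(2) by (simp only: less_eq_ennreal.rep_eq)
    finally have "M \<le> enn2ereal (S + ennreal \<eta>)" .
    then show "e2ennreal M \<le> S + ennreal \<eta>"
      using e2ennreal_mono[of M "enn2ereal (S + ennreal \<eta>)"] by simp
  qed
  then have "enn2ereal (e2ennreal M) \<le> enn2ereal S" by (simp add: less_eq_ennreal.rep_eq)
  moreover have "M \<le> enn2ereal (e2ennreal M)"
    by (cases "0 \<le> M") (auto simp: enn2ereal_e2ennreal intro: order.trans[OF _ enn2ereal_nonneg])
  ultimately show ?thesis unfolding L by (rule order.trans[rotated])
qed

theorem proposition2:
  fixes N :: "real^'m \<Rightarrow> real" and P\<zeta> :: "(real^'m) measure"
    and I :: nat and a :: "nat \<Rightarrow> real^'n \<Rightarrow> real^'m" and b :: "nat \<Rightarrow> real^'n \<Rightarrow> real"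
    and \<epsilon> \<theta> q :: real and X :: "(real^'n) set" and c :: "real^'n"
  assumes "is_norm N"
    and "borel_prob P\<zeta>" and "sub_gaussian N P\<zeta>"
    and "I \<ge> 1"
    and "\<And>i. i \<in> {1..I} \<Longrightarrow> affine_map (a i)"
    and "\<And>i. i \<in> {1..I} \<Longrightarrow> affine_map (b i)"
    and "0 < \<epsilon>" and "\<epsilon> < 1" and "0 \<le> \<theta>" and "1 \<le> q"
    and attained_sharp:
      "\<And>t. (\<exists>x\<in>X. c \<bullet> x \<le> t) \<Longrightarrow> lower_sols N P\<zeta> I a b \<epsilon> \<theta> q X c {..0} t \<noteq> {}"
    and attained_sharp_underline:
      "\<And>t. (\<exists>x\<in>X. c \<bullet> x \<le> t) \<Longrightarrow> lower_sols N P\<zeta> I a b \<epsilon> \<theta> q X c UNIV t \<noteq> {}"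
    and unique_x:
      "\<And>t x l \<beta> x' l' \<beta>'.
         (INF x\<in>X. ereal (c \<bullet> x)) \<le> ereal t \<Longrightarrow>
         (x, l, \<beta>) \<in> lower_sols N P\<zeta> I a b \<epsilon> \<theta> q X c UNIV t \<Longrightarrow>
         (x', l', \<beta>') \<in> lower_sols N P\<zeta> I a b \<epsilon> \<theta> q X c UNIV t \<Longrightarrow> x = x'"
  shows "v_sharp N P\<zeta> I a b \<epsilon> \<theta> q X c \<le> v_sharp_underline N P\<zeta> I a b \<epsilon> \<theta> q X c"
proof -
  let ?L = "L_obj N P\<zeta> I a b \<epsilon> \<theta> q"
  let ?Z = "dr_feasible N P\<zeta> I a b \<epsilon> \<theta> q"
  have sols: "(x, l, \<beta>) \<in> lower_sols N P\<zeta> I a b \<epsilon> \<theta> q X c B t \<longleftrightarrow>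
      x \<in> X \<and> c \<bullet> x \<le> t \<and> 0 \<le> l \<and> \<beta> \<in> B \<and>
      (\<forall>x' l' \<beta>'. x' \<in> X \<and> c \<bullet> x' \<le> t \<and> 0 \<le> l' \<and> \<beta>' \<in> B \<longrightarrow> ?L x l \<beta> \<le> ?L x' l' \<beta>')"
    for x l \<beta> B t
    by (auto simp: lower_sols_def is_arg_min_def not_less)
  have transfer: "\<exists>s\<in>lower_sols N P\<zeta> I a b \<epsilon> \<theta> q X c {..0} t. case s of (x, l, \<beta>) \<Rightarrow> x \<in> ?Z"
    if sol: "(x, l, \<beta>) \<in> lower_sols N P\<zeta> I a b \<epsilon> \<theta> q X c UNIV t" and x: "x \<in> ?Z" for x l \<beta> t
  proof (cases "\<beta> \<le> 0")
    case True
    then have "(x, l, \<beta>) \<in> lower_sols N P\<zeta> I a b \<epsilon> \<theta> q X c {..0} t" using sol by (simp add: sols)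
    with x show ?thesis by (intro bexI[of _ "(x, l, \<beta>)"]) simp_all
  next
    case False
    from sol have xX: "x \<in> X" "c \<bullet> x \<le> t" and l: "0 \<le> l" by (auto simp: sols)
    with attained_sharp obtain x' l' \<beta>' where
      sol': "(x', l', \<beta>') \<in> lower_sols N P\<zeta> I a b \<epsilon> \<theta> q X c {..0} t" by fastforce
    \<comment> \<open>The restricted minimum is at most the value at \<open>(x, l, \<beta>)\<close>, so its minimizer also solves the
      unrestricted problem, and uniqueness identifies it with \<open>x\<close>.\<close>
    have "?L x' l' \<beta>' \<le> ?L x l \<beta>"
      using assms(7) False sol' xX
      by (intro L_obj_zero_le[OF assms(1,2,4) _ assms(9,10) x l]) (auto simp: sols)
    then have "(x', l', \<beta>') \<in> lower_sols N P\<zeta> I a b \<epsilon> \<theta> q X c UNIV t"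
      using sol sol' unfolding sols by (blast intro: order.trans)
    moreover have "(INF x\<in>X. ereal (c \<bullet> x)) \<le> ereal t"
      using xX by (intro INF_lower2[of x]) auto
    ultimately have "x = x'" using sol by (rule unique_x[rotated 2])
    with sol' x show ?thesis by (intro bexI[OF _ sol']) simp
  qed
  show ?thesis
    unfolding alsox_value_def
  proof (rule Inf_superset_mono, rule subsetI, elim CollectE exE conjE bexE)
    fix v t and s :: "(real^'n) \<times> real \<times> real"
    assume v: "v = ereal t" and s: "s \<in> lower_sols N P\<zeta> I a b \<epsilon> \<theta> q X c UNIV t"
      "case s of (x, l, \<beta>) \<Rightarrow> x \<in> ?Z"
    obtain x l \<beta> where "s = (x, l, \<beta>)" by (cases s)
    with s transfer[of x l \<beta> t] v
    show "v \<in> {ereal t |t. \<exists>(x, l, \<beta>)\<in>lower_sols N P\<zeta> I a b \<epsilon> \<theta> q X c {..0} t. x \<in> ?Z}"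
      by auto
  qed
qed

end
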